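(* Let $(X,T)$ be the compact system described in the context (with fixed $0<\lambda<1$), and for $m\ge0$ let $\mu_m$ be the periodic measure supported on $Z_m$ (in particular $\mu_0=\delta_{(\ast,0)}$). Every $\mu\in\mathcal M(X,T)$ has a unique representation $$\mu=\sum_{m=0}^\infty w_m\mu_m,\qquad w_m\ge0,\qquad\sum_{m=0}^\infty w_m=1.$$ Moreover, the set of ergodic $T$-invariant Borel probability measures is $\{\mu_m:m\ge0\}$, and $\mu_m\to\mu_0$ in the weak$^*$ topology as $m\to\infty$.
   Context: For $m\ge1$ set $p_m=m+1$, $a_m=2^{-m}$, $Q_m=\{(m,j):j\in\mathbb Z/p_m\mathbb Z\}$; $Q_0=\{\ast\}$; $Y=\{\ast\}\sqcup\bigsqcup_{m\ge1}Q_m$. Put $r(\ast)=0$, $r(m,j)=a_m$, and $d_Y(u,v)=0$ if $u=v$, $d_Y(u,v)=r(u)+r(v)$ if $u\ne v$. $R:Y\to Y$, $R(\ast)=\ast$, $R(m,j)=(m,j+1 \bmod p_m)$. Fix $0<\lambda<1$; $X=Y\times[0,1]$ with $d_X((u,t),(v,s))=d_Y(u,v)+|t-s|$, and $T(u,t)=(Ru,\lambda t)$. $Z_m=Q_m\times\{0\}$ for $m\ge0$, and for $m\ge1$, $\mu_m=\frac1{p_m}\sum_{j=0}^{p_m-1}\delta_{((m,j),0)}$. $\mathcal M(X,T)$ is the set of $T$-invariant Borel probability measures on $X$. *)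

theory Defs
  imports "HOL-Probability.Probability"
begin

definition borel_of :: "'a topology \<Rightarrow> 'a measure" where
  "borel_of S = sigma (topspace S) {U. openin S U}"

lemma space_borel_of: "space (borel_of S) = topspace S"
  by (simp add: borel_of_def space_measure_of_conv)

lemma sets_borel_of: "sets (borel_of S) = sigma_sets (topspace S) {U. openin S U}"
  by (auto simp: borel_of_def sets_measure_of_conv dest: openin_subset)

definition invariant_probs :: "'a measure \<Rightarrow> ('a \<Rightarrow> 'a) \<Rightarrow> 'a measure set" where
  "invariant_probs B T = {\<mu>. prob_space \<mu> \<and> sets \<mu> = sets B \<and>
     (\<forall>A\<in>sets B. emeasure \<mu> (T -` A \<inter> space B) = emeasure \<mu> A)}"

definition ergodic_probs :: "'a measure \<Rightarrow> ('a \<Rightarrow> 'a) \<Rightarrow> 'a measure set" where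
  "ergodic_probs B T = {\<mu> \<in> invariant_probs B T.
     \<forall>A\<in>sets B. T -` A \<inter> space B = A \<longrightarrow> emeasure \<mu> A = 0 \<or> emeasure \<mu> A = 1}"

definition mixture :: "'a measure \<Rightarrow> (nat \<Rightarrow> real) \<Rightarrow> (nat \<Rightarrow> 'a measure) \<Rightarrow> 'a measure" where
  "mixture B w \<nu> = measure_of (space B) (sets B) (\<lambda>A. \<Sum>m. ennreal (w m) * emeasure (\<nu> m) A)"

text \<open>The set function in the definition of \<^const>\<open>mixture\<close> is countably additive, so
  \<^const>\<open>measure_of\<close> does not fall back to the zero measure.\<close>

lemma sets_mixture [simp]: "sets (mixture B w \<nu>) = sets B"
  by (simp add: mixture_def)

lemma space_mixture [simp]: "space (mixture B w \<nu>) = space B"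
  by (simp add: mixture_def)

lemma emeasure_mixture:
  assumes "\<And>m. sets (\<nu> m) = sets B" and A: "A \<in> sets B"
  shows "emeasure (mixture B w \<nu>) A = (\<Sum>m. ennreal (w m) * emeasure (\<nu> m) A)"
  unfolding mixture_def
proof (rule emeasure_measure_of_sigma)
  show "sigma_algebra (space B) (sets B)" by (rule sets.sigma_algebra_axioms)
  show "positive (sets B) (\<lambda>A. \<Sum>m. ennreal (w m) * emeasure (\<nu> m) A)"
    by (simp add: positive_def)
  show "countably_additive (sets B) (\<lambda>A. \<Sum>m. ennreal (w m) * emeasure (\<nu> m) A)"
  proof (rule countably_additiveI)
    fix F :: "nat \<Rightarrow> 'a set"
    assume F: "range F \<subseteq> sets B" "disjoint_family F"
    have "(\<Sum>i. \<Sum>m. ennreal (w m) * emeasure (\<nu> m) (F i)) =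
          (\<Sum>i. \<integral>\<^sup>+m. ennreal (w m) * emeasure (\<nu> m) (F i) \<partial>count_space UNIV)"
      by (simp add: nn_integral_count_space_nat)
    also have "\<dots> = (\<integral>\<^sup>+m. (\<Sum>i. ennreal (w m) * emeasure (\<nu> m) (F i)) \<partial>count_space UNIV)"
      by (subst nn_integral_suminf) auto
    also have "\<dots> = (\<Sum>m. \<Sum>i. ennreal (w m) * emeasure (\<nu> m) (F i))"
      by (simp add: nn_integral_count_space_nat)
    also have "\<dots> = (\<Sum>m. ennreal (w m) * emeasure (\<nu> m) (\<Union>(range F)))"
      using F assms(1) by (simp add: suminf_emeasure)
    finally show "(\<Sum>i. \<Sum>m. ennreal (w m) * emeasure (\<nu> m) (F i)) =
      (\<Sum>m. ennreal (w m) * emeasure (\<nu> m) (\<Union>(range F)))" .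
  qed
qed (rule A)

text \<open>Only used for compact \<open>S\<close>, where every continuous real function is bounded.\<close>

definition weak_star_converges ::
    "'a topology \<Rightarrow> (nat \<Rightarrow> 'a measure) \<Rightarrow> 'a measure \<Rightarrow> bool" where
  "weak_star_converges S \<nu> \<mu> \<longleftrightarrow>
     (\<forall>f :: 'a \<Rightarrow> real. continuous_map S euclideanreal f \<longrightarrow>
        (\<lambda>m. integral\<^sup>L (\<nu> m) f) \<longlonglongrightarrow> integral\<^sup>L \<mu> f)"

text \<open>\<open>Cyc m j\<close> is the point \<open>(m, j)\<close>, the residue class \<open>j\<close> modulo \<open>per m\<close> being given by its
  representative in \<open>{0..<per m}\<close>.  The remaining values of the datatype, in particular all
  \<open>Cyc 0 j\<close>, lie outside \<open>YY\<close>.\<close>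

datatype ypoint = Star | Cyc nat nat

definition per :: "nat \<Rightarrow> nat" where "per m = m + 1"

definition rad :: "nat \<Rightarrow> real" where "rad m = 1 / 2 ^ m"

definition QY :: "nat \<Rightarrow> ypoint set" where
  "QY m = (if m = 0 then {Star} else {Cyc m j | j. j < per m})"

definition YY :: "ypoint set" where "YY = (\<Union>m. QY m)"

fun rY :: "ypoint \<Rightarrow> real" where
  "rY Star = 0"
| "rY (Cyc m j) = rad m"

definition dY :: "ypoint \<Rightarrow> ypoint \<Rightarrow> real" where
  "dY u v = (if u = v then 0 else rY u + rY v)"

fun RY :: "ypoint \<Rightarrow> ypoint" where
  "RY Star = Star"
| "RY (Cyc m j) = Cyc m ((j + 1) mod per m)"

definition XX :: "(ypoint \<times> real) set" where "XX = YY \<times> {0..1}"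

definition dX :: "ypoint \<times> real \<Rightarrow> ypoint \<times> real \<Rightarrow> real" where
  "dX x y = dY (fst x) (fst y) + \<bar>snd x - snd y\<bar>"

definition TX :: "real \<Rightarrow> ypoint \<times> real \<Rightarrow> ypoint \<times> real" where
  "TX lam x = (RY (fst x), lam * snd x)"

lemma r_nonneg: "0 \<le> rY u"
  by (cases u) (auto simp: rad_def)

lemma Star_in_YY: "Star \<in> YY"
  by (auto simp: YY_def QY_def intro!: exI[of _ 0])

lemma Cyc_in_YY: "Cyc m j \<in> YY \<longleftrightarrow> 1 \<le> m \<and> j < per m"
  by (auto simp: YY_def QY_def)

lemma r_eq_0: "rY u = 0 \<longleftrightarrow> u = Star"
  by (cases u) (auto simp: rad_def)

lemma dY_eq_0: "dY u v = 0 \<longleftrightarrow> u = v"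
  using r_nonneg[of u] r_nonneg[of v] r_eq_0[of u] r_eq_0[of v] by (auto simp: dY_def)

lemma dY_nonneg: "0 \<le> dY u v"
  using r_nonneg[of u] r_nonneg[of v] by (auto simp: dY_def)

lemma dY_triangle: "dY u w \<le> dY u v + dY v w"
  using r_nonneg[of u] r_nonneg[of v] r_nonneg[of w] by (auto simp: dY_def)

interpretation XX: Metric_space XX dX
proof
  fix x y z
  show "0 \<le> dX x y" using dY_nonneg by (simp add: dX_def)
  show "dX x y = dX y x" by (auto simp: dX_def dY_def)
  show "dX x y = 0 \<longleftrightarrow> x = y"
    using dY_nonneg[of "fst x" "fst y"] dY_eq_0[of "fst x" "fst y"]
    by (auto simp: dX_def prod_eq_iff)
  show "dX x z \<le> dX x y + dX y z"
    using dY_triangle[of "fst x" "fst z" "fst y"] by (auto simp: dX_def)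
qed

abbreviation topX :: "(ypoint \<times> real) topology" where "topX \<equiv> XX.mtopology"

abbreviation borelX :: "(ypoint \<times> real) measure" where "borelX \<equiv> borel_of topX"

definition ZX :: "nat \<Rightarrow> (ypoint \<times> real) set" where "ZX m = QY m \<times> {0}"

definition mu :: "nat \<Rightarrow> (ypoint \<times> real) measure" where
  "mu m = (if m = 0 then return borelX (Star, 0)
     else measure_of (space borelX) (sets borelX)
            (\<lambda>A. (\<Sum>j<per m. emeasure (return borelX (Cyc m j, 0)) A) / of_nat (per m)))"

lemma RY_in_YY: "u \<in> YY \<Longrightarrow> RY u \<in> YY"
  by (cases u) (auto simp: Star_in_YY Cyc_in_YY per_def)

lemma TX_in_XX: "x \<in> XX \<Longrightarrow> 0 < lam \<Longrightarrow> lam < 1 \<Longrightarrow> TX lam x \<in> XX"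
  by (auto simp: XX_def TX_def RY_in_YY mult_le_one)

lemma continuous_TX:
  assumes "0 < lam" "lam < 1"
  shows "continuous_map topX topX (TX lam)"
proof -
  have rRY: "rY (RY u) = rY u" for u by (cases u) auto
  have "dX (TX lam x) (TX lam y) \<le> dX x y" for x y
  proof -
    have "dY (RY (fst x)) (RY (fst y)) \<le> dY (fst x) (fst y)"
      using r_nonneg rRY by (auto simp: dY_def)
    moreover have "\<bar>lam * snd x - lam * snd y\<bar> \<le> \<bar>snd x - snd y\<bar>"
      using assms by (simp add: abs_mult mult_left_le_one_le flip: right_diff_distrib)
    ultimately show ?thesis by (simp add: dX_def TX_def)
  qed
  then show ?thesis
    using assms TX_in_XX unfolding XX.metric_continuous_map[OF XX.Metric_space_axioms]
    by (meson image_subsetI le_less_trans)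
qed

lemma compact_XX: "compact_space topX"
  unfolding XX.compact_space_sequentially
proof (intro allI impI)
  fix x :: "nat \<Rightarrow> ypoint \<times> real"
  assume "range x \<subseteq> XX"
  then have xXX: "x n \<in> XX" for n by auto
  have "\<forall>n. snd (x n) \<in> {0..1}" using xXX by (auto simp: XX_def mem_Times_iff)
  then obtain t and s :: "nat \<Rightarrow> nat" where t: "t \<in> {0..1}" "strict_mono s"
      "(\<lambda>n. snd (x (s n))) \<longlonglongrightarrow> t"
    using seq_compactE[OF compact_imp_seq_compact[OF compact_Icc[of 0 "1::real"]],
        of "snd \<circ> x"] by (auto simp: o_def)
  define u where "u n = fst (x (s n))" for n
  have uYY: "u n \<in> YY" for n using xXX[of "s n"] by (auto simp: u_def XX_def)
  have *: "\<exists>v q. v \<in> YY \<and> strict_mono (q :: nat \<Rightarrow> nat) \<and> (\<lambda>n. dY (u (q n)) v) \<longlonglongrightarrow> 0"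
  proof (cases "\<exists>v. infinite {n. u n = v}")
    case True
    then obtain v where v: "infinite {n. u n = v}" by blast
    let ?q = "enumerate {n. u n = v}"
    have "u (?q n) = v" for n using enumerate_in_set[OF v, of n] by simp
    then show ?thesis using strict_mono_enumerate[OF v] uYY[of "?q 0"]
      by (intro exI[of _ v] exI[of _ ?q]) (auto simp: dY_def)
  next
    case False
    have fin: "finite {n. u n \<in> F}" if "finite F" for F
    proof -
      have "{n. u n \<in> F} = (\<Union>v\<in>F. {n. u n = v})" by auto
      then show ?thesis using False that by simp
    qed
    have "(\<lambda>n. rY (u n)) \<longlonglongrightarrow> 0"
    proof (rule LIMSEQ_I)
      fix e :: real assume "0 < e"
      then obtain N where N: "(1/2::real) ^ N < e"
        using real_arch_pow_inv[of e "1/2"] by auto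
      let ?F = "(\<Union>m<N. QY m) \<union> {Star}"
      have "finite (QY m)" for m by (simp add: QY_def)
      then have "finite {n. u n \<in> ?F}" by (intro fin) auto
      then obtain M where M: "\<And>n. u n \<in> ?F \<Longrightarrow> n < M"
        unfolding finite_nat_set_iff_bounded by blast
      have "norm (rY (u n) - 0) < e" if "n \<ge> M" for n
      proof (cases "u n")
        case (Cyc m j)
        have "u n \<notin> ?F" using M[of n] that by auto
        then have "m \<ge> N" using uYY[of n] Cyc by (auto simp: Cyc_in_YY QY_def)
        then have "rad m \<le> (1/2) ^ N"
          using power_decreasing[of N m "1/2::real"] by (simp add: rad_def power_one_over)
        then show ?thesis using N Cyc by (simp add: rad_def)
      qed (use \<open>0 < e\<close> in simp)
      then show "\<exists>M. \<forall>n\<ge>M. norm (rY (u n) - 0) < e" by blast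
    qed
    moreover have "dY (u n) Star = rY (u n)" for n by (auto simp: dY_def)
    ultimately show ?thesis using Star_in_YY
      by (intro exI[of _ Star] exI[of _ id]) (auto simp: strict_mono_def)
  qed
  then obtain v q where v: "v \<in> YY" "strict_mono (q :: nat \<Rightarrow> nat)"
      "(\<lambda>n. dY (u (q n)) v) \<longlonglongrightarrow> 0" by blast
  have "(\<lambda>n. snd (x (s (q n)))) \<longlonglongrightarrow> t"
    using LIMSEQ_subseq_LIMSEQ[OF t(3) v(2)] by (simp add: o_def)
  then have "(\<lambda>n. \<bar>snd (x (s (q n))) - t\<bar>) \<longlonglongrightarrow> 0"
    using tendsto_rabs_zero LIM_zero by blast
  with v(3) have "(\<lambda>n. dX (x (s (q n))) (v, t)) \<longlonglongrightarrow> 0"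
    using tendsto_add[of _ 0 _ _ 0] by (fastforce simp: dX_def u_def)
  moreover have "(v, t) \<in> XX" using v t by (simp add: XX_def)
  ultimately have "limitin topX (x \<circ> (s \<circ> q)) (v, t) sequentially"
    using xXX unfolding XX.limitin_metric_dist_null by (simp add: o_def)
  then show "\<exists>l q. l \<in> XX \<and> strict_mono q \<and> limitin topX (x \<circ> q) l sequentially"
    using \<open>(v, t) \<in> XX\<close> strict_mono_o[OF t(2) v(2)] by blast
qed

lemma sets_mu [simp]: "sets (mu m) = sets borelX"
  by (simp add: mu_def)

lemma emeasure_mu:
  assumes "1 \<le> m" and A: "A \<in> sets borelX"
  shows "emeasure (mu m) A =
    (\<Sum>j<per m. emeasure (return borelX (Cyc m j, 0)) A) / of_nat (per m)"
proof -
  have eq: "mu m = measure_of (space borelX) (sets borelX)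
      (\<lambda>A. (\<Sum>j<per m. emeasure (return borelX (Cyc m j, 0)) A) / of_nat (per m))"
    using assms by (simp add: mu_def)
  show ?thesis unfolding eq
  proof (rule emeasure_measure_of_sigma)
    show "sigma_algebra (space borelX) (sets borelX)" by (rule sets.sigma_algebra_axioms)
    show "positive (sets borelX)
        (\<lambda>A. (\<Sum>j<per m. emeasure (return borelX (Cyc m j, 0)) A) / of_nat (per m))"
      by (simp add: positive_def)
    show "countably_additive (sets borelX)
        (\<lambda>A. (\<Sum>j<per m. emeasure (return borelX (Cyc m j, 0)) A) / of_nat (per m))"
    proof (rule countably_additiveI)
      fix F :: "nat \<Rightarrow> (ypoint \<times> real) set"
      assume F: "range F \<subseteq> sets borelX" "disjoint_family F"
      have "(\<Sum>i. (\<Sum>j<per m. emeasure (return borelX (Cyc m j, 0)) (F i)) / of_nat (per m)) =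
          (\<Sum>j<per m. \<Sum>i. emeasure (return borelX (Cyc m j, 0)) (F i)) / of_nat (per m)"
        by (simp add: divide_ennreal_def suminf_sum summableI)
      also have "\<dots> = (\<Sum>j<per m. emeasure (return borelX (Cyc m j, 0)) (\<Union>(range F))) / of_nat (per m)"
        using F by (simp add: suminf_emeasure del: emeasure_return)
      finally show "(\<Sum>i. (\<Sum>j<per m. emeasure (return borelX (Cyc m j, 0)) (F i)) / of_nat (per m)) =
          (\<Sum>j<per m. emeasure (return borelX (Cyc m j, 0)) (\<Union>(range F))) / of_nat (per m)" .
    qed
  qed (rule A)
qed

lemma singleton_in_sets: "x \<in> XX \<Longrightarrow> {x} \<in> sets borelX"
proof -
  assume "x \<in> XX"
  then have "openin topX (XX - {x})"
    using XX.closedin_metric XX.t1_space_mtopology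
    by (metis XX.topspace_mtopology closedin_def closedin_t1_singleton)
  then have "XX - (XX - {x}) \<in> sigma_sets XX {U. openin topX U}"
    by (intro sigma_sets.Compl sigma_sets.Basic) simp
  moreover have "XX - (XX - {x}) = {x}" using \<open>x \<in> XX\<close> by auto
  ultimately show ?thesis by (simp add: sets_borel_of)
qed

text \<open>\<open>mu m\<close> is supported on \<open>ZX m\<close>.\<close>

lemma emeasure_mu_Z: "emeasure (mu m) (ZX m) = 1"
proof -
  have fin: "finite (ZX m)" by (simp add: ZX_def QY_def)
  have "ZX m \<subseteq> XX" by (auto simp: ZX_def XX_def YY_def)
  then have "(\<Union>z\<in>ZX m. {z}) \<in> sets borelX"
    using fin singleton_in_sets by (intro sets.finite_UN) auto
  then have Zs: "ZX m \<in> sets borelX" by simp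
  show ?thesis
  proof (cases "m = 0")
    case True
    then show ?thesis using Zs by (simp add: mu_def ZX_def QY_def)
  next
    case False
    then have "(Cyc m j, 0) \<in> ZX m" if "j < per m" for j
      using that by (auto simp: ZX_def QY_def)
    then have "(\<Sum>j<per m. emeasure (return borelX (Cyc m j, 0)) (ZX m)) = of_nat (per m)"
      using Zs by simp
    then have "emeasure (mu m) (ZX m) = of_nat (per m) / of_nat (per m)"
      using False Zs emeasure_mu[of m "ZX m"] by simp
    also have "\<dots> = 1"
      by (rule ennreal_divide_self) (auto simp: per_def of_nat_less_top simp del: of_nat_Suc of_nat_add)
    finally show ?thesis .
  qed
qed

end

theory Submission
  imports Defs
begin

text \<open>\<open>T\<close> contracts the fibre \<open>[0,1]\<close>, so an invariant probability gives full mass to each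
  \<open>Y \<times> [0, lam ^ n]\<close>, hence to the countable set \<open>Y \<times> {0}\<close>, the disjoint union of the cycles
  \<open>Z\<^sub>m\<close>. Invariance makes point masses constant along a cycle, so \<open>\<mu> (A \<inter> Z\<^sub>m) = \<mu> Z\<^sub>m * \<mu>\<^sub>m A\<close>.
  Everything follows from this, the weights being \<open>\<mu> Z\<^sub>m\<close>; convergence to \<open>\<mu>\<^sub>0\<close> holds because
  \<open>Z\<^sub>m\<close> shrinks to \<open>(*, 0)\<close>.\<close>

section \<open>The space and its cycles\<close>

lemma space_borelX [simp]: "space borelX = XX"
  by (simp add: space_borel_of)

lemma openin_sets_borelX: "openin topX U \<Longrightarrow> U \<in> sets borelX"
  by (simp add: sets_borel_of)

text \<open>The complement is open: the height \<open>snd\<close> is 1-Lipschitz for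
  \<open>dX\<close>, so the ball of radius \<open>snd x - c\<close> around a point \<open>x\<close>
  above height \<open>c\<close> stays above \<open>c\<close>.\<close>

lemma fibre_atMost_sets: "{x \<in> XX. snd x \<le> c} \<in> sets borelX"
proof -
  have "openin topX {x \<in> XX. c < snd x}"
    unfolding XX.openin_mtopology
  proof (intro conjI allI impI)
    fix x assume x: "x \<in> {x \<in> XX. c < snd x}"
    have "XX.mball x (snd x - c) \<subseteq> {x \<in> XX. c < snd x}"
    proof
      fix y assume "y \<in> XX.mball x (snd x - c)"
      then show "y \<in> {x \<in> XX. c < snd x}"
        using dY_nonneg[of "fst x" "fst y"] by (auto simp: dX_def)
    qed
    then show "\<exists>r>0. XX.mball x r \<subseteq> {x \<in> XX. c < snd x}"
      using x by (intro exI[of _ "snd x - c"]) auto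
  qed auto
  then have "space borelX - {x \<in> XX. c < snd x} \<in> sets borelX"
    by (intro sets.compl_sets openin_sets_borelX)
  moreover have "space borelX - {x \<in> XX. c < snd x} = {x \<in> XX. snd x \<le> c}" by auto
  ultimately show ?thesis by simp
qed

lemma continuous_map_measurable_borelX:
  assumes "continuous_map topX euclideanreal f"
  shows "f \<in> borel_measurable borelX"
proof (rule borel_measurableI)
  fix S :: "real set" assume "open S"
  then have "openin topX {x \<in> topspace topX. f x \<in> S}"
    using assms by (simp add: continuous_map_def)
  moreover have "{x \<in> topspace topX. f x \<in> S} = f -` S \<inter> space borelX" by auto
  ultimately show "f -` S \<inter> space borelX \<in> sets borelX" using openin_sets_borelX by simp
qed

lemma ZX_eq_image: "1 \<le> m \<Longrightarrow> ZX m = (\<lambda>j. (Cyc m j, 0)) ` {..<per m}"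
  by (auto simp: ZX_def QY_def)

lemma ZX_0: "ZX 0 = {(Star, 0)}"
  by (simp add: ZX_def QY_def)

lemma finite_ZX [simp]: "finite (ZX m)"
  by (simp add: ZX_def QY_def)

lemma ZX_subset: "ZX m \<subseteq> XX"
  by (auto simp: ZX_def XX_def YY_def)

lemma ZX_sets [simp]: "ZX m \<in> sets borelX"
proof -
  have "(\<Union>z\<in>ZX m. {z}) \<in> sets borelX"
    using singleton_in_sets ZX_subset by (intro sets.finite_UN) auto
  then show ?thesis by simp
qed

lemma disjoint_ZX: "disjoint_family ZX"
  by (auto simp: disjoint_family_on_def ZX_def QY_def split: if_splits)

lemma UN_ZX_sets: "(\<Union>m. ZX m) \<in> sets borelX"
  by (rule sets.countable_UN) auto

lemma UN_ZX: "(\<Union>m. ZX m) = YY \<times> {0}"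
  by (auto simp: ZX_def YY_def)

section \<open>Action of T on the cycles\<close>

lemma inj_on_RY: "inj_on RY YY"
proof (rule inj_onI)
  fix u v assume "u \<in> YY" "v \<in> YY" "RY u = RY v"
  \<comment> \<open>Membership in \<open>YY\<close> is essential: \<open>RY\<close> identifies
    \<open>Cyc m (per m)\<close>, a value outside \<open>YY\<close>, with
    \<open>Cyc m 0\<close>.\<close>
  then show "u = v"
    by (cases u; cases v) (auto simp: Cyc_in_YY per_def mod_Suc split: if_splits)
qed

lemma inj_on_TX: "0 < lam \<Longrightarrow> inj_on (TX lam) XX"
  using inj_on_RY by (auto simp: inj_on_def TX_def XX_def)

text \<open>The backward direction is invariance of the cycle; the forward one uses
  \<open>lam\<close> nonzero, so that height 0 in the image forces height 0 before. Each cycle thus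
  equals its own preimage, as the 0-1 law for ergodic measures demands.\<close>

lemma TX_in_ZX_iff:
  assumes "0 < lam" "x \<in> XX"
  shows "TX lam x \<in> ZX m \<longleftrightarrow> x \<in> ZX m"
  using assms
  by (cases x; cases "fst x") (auto simp: TX_def XX_def ZX_def QY_def Cyc_in_YY per_def)

text \<open>An injective self-map of a finite set is onto. This permits reindexing sums over a cycle
  along \<open>TX lam\<close>.\<close>

lemma bij_betw_TX_ZX:
  assumes "0 < lam"
  shows "bij_betw (TX lam) (ZX m) (ZX m)"
proof -
  have "inj_on (TX lam) (ZX m)"
    using inj_on_TX[OF assms] ZX_subset inj_on_subset by blast
  moreover have "TX lam ` ZX m \<subseteq> ZX m"
    using TX_in_ZX_iff[OF assms] ZX_subset by blast
  ultimately show ?thesis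
    by (simp add: bij_betw_def endo_inj_surj)
qed

text \<open>The map is transitive on a cycle: every point is an iterate of
  \<open>(Cyc m 0, 0)\<close>. It is used with \<open>g\<close> a membership predicate (ergodicity)
  and with \<open>g\<close> a point mass (decomposition).\<close>

lemma TX_invariant_const_on_ZX:
  assumes inv: "\<And>x. x \<in> ZX m \<Longrightarrow> g (TX lam x) = g x"
    and "x \<in> ZX m" "y \<in> ZX m"
  shows "g x = g y"
proof (cases "m = 0")
  case True
  then show ?thesis using assms by (simp add: ZX_0)
next
  case False
  have base: "j < per m \<Longrightarrow> g (Cyc m j, 0) = g (Cyc m 0, 0)" for j
  proof (induction j)
    case (Suc j)
    \<comment> \<open>\<open>Suc j < per m\<close>, so reduction modulo \<open>per m\<close> changes
      nothing and the induction never wraps around.\<close>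
    then have "TX lam (Cyc m j, 0) = (Cyc m (Suc j), 0)" by (simp add: TX_def)
    moreover have "(Cyc m j, 0) \<in> ZX m" using False Suc.prems by (simp add: ZX_eq_image)
    ultimately show ?case using inv[of "(Cyc m j, 0)"] Suc by simp
  qed simp
  have "g z = g (Cyc m 0, 0)" if "z \<in> ZX m" for z
    using that False base by (auto simp: ZX_eq_image)
  then show ?thesis using assms(2,3) by metis
qed

section \<open>The periodic measures\<close>

text \<open>One formula for all \<open>m\<close>, the fixed point being a cycle of length
  \<open>per 0 = 1\<close>. Summing over points instead of residues prepares the reindexing along
  \<open>TX lam\<close>.\<close>

lemma emeasure_mu_eq_sum:
  assumes A: "A \<in> sets borelX"
  shows "emeasure (mu m) A = (\<Sum>x\<in>ZX m. indicator A x) / of_nat (per m)"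
proof (cases "m = 0")
  case True
  then show ?thesis using A by (simp add: mu_def ZX_0 per_def divide_ennreal_def)
next
  case False
  moreover have "inj_on (\<lambda>j. (Cyc m j, 0::real)) {..<per m}" by (auto simp: inj_on_def)
  ultimately show ?thesis using A
    by (simp add: emeasure_mu ZX_eq_image sum.reindex)
qed

lemma space_mu [simp]: "space (mu m) = XX"
  using sets_eq_imp_space_eq[OF sets_mu] by simp

lemma card_ZX: "card (ZX m) = per m"
proof (cases "m = 0")
  case True
  then show ?thesis by (simp add: ZX_0 per_def)
next
  case False
  then show ?thesis by (simp add: ZX_eq_image card_image inj_on_def)
qed

lemma emeasure_mu_eq_1:
  assumes "A \<in> sets borelX" "ZX m \<subseteq> A"
  shows "emeasure (mu m) A = 1"
proof -
  have "(\<Sum>x\<in>ZX m. indicator A x :: ennreal) = (\<Sum>x\<in>ZX m. 1)"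
    using assms(2) by (intro sum.cong) (auto simp: indicator_def)
  then have "emeasure (mu m) A = of_nat (per m) / of_nat (per m)"
    using assms(1) by (simp add: emeasure_mu_eq_sum card_ZX)
  also have "\<dots> = 1"
    by (rule ennreal_divide_self[OF _ of_nat_less_top]) (simp add: per_def)
  finally show ?thesis .
qed

lemma emeasure_mu_eq_0:
  assumes "A \<in> sets borelX" "ZX m \<inter> A = {}"
  shows "emeasure (mu m) A = 0"
  using assms by (auto simp: emeasure_mu_eq_sum indicator_def)

lemma prob_space_mu: "prob_space (mu m)"
  using emeasure_mu_eq_1[of XX m] ZX_subset sets.top[of borelX] by (intro prob_spaceI) simp

lemma mu_invariant:
  assumes "0 < lam" "lam < 1"
  shows "mu m \<in> invariant_probs borelX (TX lam)"
proof -
  have "TX lam -` A \<inter> XX \<in> sets borelX \<and> emeasure (mu m) (TX lam -` A \<inter> XX) = emeasure (mu m) A"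
    if A: "A \<in> sets borelX" for A
  proof -
    \<comment> \<open>The sum formula applies only to Borel sets, so preimages must be Borel;
      continuity gives this on the generating open sets.\<close>
    have "TX lam \<in> measurable borelX borelX"
    proof (rule measurable_sigma_sets)
      show "sets borelX = sigma_sets XX {U. openin topX U}" by (simp add: sets_borel_of)
      show "{U. openin topX U} \<subseteq> Pow XX" using openin_subset by fastforce
      show "TX lam \<in> space borelX \<rightarrow> XX" using TX_in_XX assms by auto
      fix U assume "U \<in> {U. openin topX U}"
      then have "openin topX {x \<in> topspace topX. TX lam x \<in> U}"
        using continuous_TX[OF assms] by (simp add: continuous_map_def)
      moreover have "{x \<in> topspace topX. TX lam x \<in> U} = TX lam -` U \<inter> space borelX" by auto
      ultimately show "TX lam -` U \<inter> space borelX \<in> sets borelX"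
        using openin_sets_borelX by simp
    qed
    from measurable_sets[OF this A] have pre: "TX lam -` A \<inter> XX \<in> sets borelX" by simp
    have "(\<Sum>x\<in>ZX m. indicator (TX lam -` A \<inter> XX) x :: ennreal) = (\<Sum>x\<in>ZX m. indicator A (TX lam x))"
      using ZX_subset[of m] by (intro sum.cong) (auto simp: indicator_def)
    also have "\<dots> = (\<Sum>x\<in>ZX m. indicator A x)"
      by (rule sum.reindex_bij_betw[OF bij_betw_TX_ZX[OF assms(1)]])
    finally show ?thesis using A pre by (simp add: emeasure_mu_eq_sum)
  qed
  then show ?thesis by (simp add: invariant_probs_def prob_space_mu)
qed

text \<open>Membership in an invariant set is constant along a cycle, so the set contains
  \<open>ZX m\<close> or misses it.\<close>

lemma mu_ergodic:
  assumes "0 < lam" "lam < 1"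
  shows "mu m \<in> ergodic_probs borelX (TX lam)"
proof -
  have "emeasure (mu m) A = 0 \<or> emeasure (mu m) A = 1"
    if A: "A \<in> sets borelX" and inv: "TX lam -` A \<inter> XX = A" for A
  proof -
    have "(TX lam x \<in> A) = (x \<in> A)" if "x \<in> ZX m" for x
      using inv that ZX_subset[of m] by auto
    then have "(x \<in> A) = (y \<in> A)" if "x \<in> ZX m" "y \<in> ZX m" for x y
      using that by (rule TX_invariant_const_on_ZX)
    then have "ZX m \<subseteq> A \<or> ZX m \<inter> A = {}" by blast
    then show ?thesis using A emeasure_mu_eq_0 emeasure_mu_eq_1 by blast
  qed
  then show ?thesis using mu_invariant[OF assms] by (simp add: ergodic_probs_def)
qed

section \<open>Weak* convergence of the periodic measures\<close>

lemma mu_weak_star_converges: "weak_star_converges topX mu (mu 0)"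
  unfolding weak_star_converges_def
proof (intro allI impI)
  fix f :: "ypoint \<times> real \<Rightarrow> real"
  assume f: "continuous_map topX euclideanreal f"
  define c where "c = f (Star, 0)"
  have star: "(Star, 0) \<in> XX" by (simp add: XX_def Star_in_YY)
  have meas: "f \<in> borel_measurable (mu m)" for m
    using continuous_map_measurable_borelX[OF f] measurable_cong_sets[OF sets_mu refl] by blast
  have "integral\<^sup>L (mu 0) f = c"
    using continuous_map_measurable_borelX[OF f] star by (simp add: mu_def c_def integral_return)
  moreover have "(\<lambda>m. integral\<^sup>L (mu m) f) \<longlonglongrightarrow> c"
  proof (rule LIMSEQ_I)
    fix e :: real assume e: "0 < e"
    \<comment> \<open>Radius \<open>e/2\<close> because integration preserves only weak
      inequalities, while the final bound must be strictly below \<open>e\<close>.\<close>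
    have "openin topX {x \<in> topspace topX. f x \<in> ball c (e/2)}"
      using f by (simp only: continuous_map_def open_openin[symmetric] open_ball)
    moreover have "(Star, 0) \<in> {x \<in> topspace topX. f x \<in> ball c (e/2)}"
      using star e by (simp add: c_def)
    ultimately obtain d where d: "d > 0"
      "XX.mball (Star, 0) d \<subseteq> {x \<in> topspace topX. f x \<in> ball c (e/2)}"
      unfolding XX.openin_mtopology by meson
    obtain N where N: "(1/2::real) ^ N < d" using real_arch_pow_inv[OF d(1), of "1/2"] by auto
    have "norm (integral\<^sup>L (mu m) f - c) < e" if "m \<ge> N" for m
    proof -
      interpret prob_space "mu m" by (rule prob_space_mu)
      \<comment> \<open>For \<open>m\<close> at least 1, \<open>rad m\<close> is the distance from
        \<open>(Star, 0)\<close> to every point of \<open>ZX m\<close>.\<close>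
      have "rad m \<le> (1/2) ^ N"
        using power_decreasing[OF that, of "1/2::real"] by (simp add: rad_def power_one_over)
      then have "rad m < d" using N by simp
      then have "ZX m \<subseteq> XX.mball (Star, 0) d"
        using star d(1) ZX_subset[of m]
        by (cases "m = 0")
          (auto simp: dX_def dY_def ZX_0 ZX_eq_image)
      then have in_ball: "f x \<in> ball c (e/2)" if "x \<in> ZX m" for x using that d(2) by blast
      have near: "\<bar>f x - c\<bar> \<le> e/2" if "x \<in> ZX m" for x
        using in_ball[OF that] by (simp add: dist_real_def abs_minus_commute)
      have "prob (ZX m) = 1" using emeasure_mu_Z[of m] by (simp add: measure_def)
      then have "AE x in mu m. x \<in> ZX m"
        using prob_eq_1[of "ZX m"] by simp
      then have ae: "AE x in mu m. \<bar>f x - c\<bar> \<le> e/2"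
        by (rule AE_mp) (use near in auto)
      have int: "integrable (mu m) f"
      proof (rule integrable_const_bound)
        show "AE x in mu m. norm (f x) \<le> \<bar>c\<bar> + e/2"
          using ae
        proof eventually_elim
          fix x assume "\<bar>f x - c\<bar> \<le> e/2"
          then show "norm (f x) \<le> \<bar>c\<bar> + e/2"
            using abs_triangle_ineq[of "f x - c" c] by simp
        qed
      qed (rule meas)
      have "norm (integral\<^sup>L (mu m) f - c) = norm (\<integral>x. f x - c \<partial>mu m)"
        using int prob_space by simp
      also have "\<dots> \<le> (\<integral>x. norm (f x - c) \<partial>mu m)" by (rule integral_norm_bound)
      also have "\<dots> \<le> e/2"
        using int ae by (intro integral_le_const) auto
      also have "\<dots> < e" using e by simp
      finally show ?thesis .
    qed
    then show "\<exists>N. \<forall>m\<ge>N. norm (integral\<^sup>L (mu m) f - c) < e" by blast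
  qed
  ultimately show "(\<lambda>m. integral\<^sup>L (mu m) f) \<longlonglongrightarrow> integral\<^sup>L (mu 0) f" by simp
qed

section \<open>Invariant measures\<close>

lemma (in prob_space) AE_in_if_emeasure_eq_1:
  "A \<in> events \<Longrightarrow> emeasure M A = 1 \<Longrightarrow> AE x in M. x \<in> A"
  by (simp add: AE_in_set_eq_1 emeasure_eq_measure)

lemma invariant_probsD:
  assumes "\<mu> \<in> invariant_probs borelX (TX lam)"
  shows "prob_space \<mu>" "sets \<mu> = sets borelX" "space \<mu> = XX"
    "A \<in> sets borelX \<Longrightarrow> emeasure \<mu> (TX lam -` A \<inter> XX) = emeasure \<mu> A"
  using assms sets_eq_imp_space_eq[of \<mu> borelX] by (auto simp: invariant_probs_def)

lemma invariant_emeasure_zero_fibre: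
  assumes lam: "0 < lam" "lam < 1" and \<mu>: "\<mu> \<in> invariant_probs borelX (TX lam)"
  shows "emeasure \<mu> (\<Union>m. ZX m) = 1"
proof -
  note inv = invariant_probsD[OF \<mu>]
  interpret prob_space \<mu> by (rule inv)
  define K where "K n = {x \<in> XX. snd x \<le> lam ^ n}" for n
  have K: "K n \<in> sets borelX" for n unfolding K_def by (rule fibre_atMost_sets)
  have eq1: "emeasure \<mu> (K n) = 1" for n
  proof (induction n)
    case 0
    have "K 0 = space \<mu>" by (auto simp: K_def inv XX_def)
    then show ?case by (simp add: emeasure_space_1)
  next
    case (Suc n)
    \<comment> \<open>Heights are multiplied by \<open>lam > 0\<close>, so one factor cancels;
      invariance then carries full mass from \<open>K n\<close> to \<open>K (Suc n)\<close>.\<close>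
    have "TX lam -` K (Suc n) \<inter> XX = K n"
      using TX_in_XX lam by (auto simp: K_def) (auto simp: TX_def)
    then show ?case using inv(4)[OF K[of "Suc n"]] Suc by simp
  qed
  have "(\<Inter>n. K n) = YY \<times> {0}"
  proof
    show "(\<Inter>n. K n) \<subseteq> YY \<times> {0}"
    proof
      fix x assume x: "x \<in> (\<Inter>n. K n)"
      have "snd x \<le> 0"
        by (rule LIMSEQ_le_const[OF LIMSEQ_realpow_zero[of lam]]) (use lam x in \<open>auto simp: K_def\<close>)
      then show "x \<in> YY \<times> {0}" using x by (auto simp: K_def XX_def)
    qed
    show "YY \<times> {0} \<subseteq> (\<Inter>n. K n)" using lam by (auto simp: K_def XX_def)
  qed
  moreover have "AE x in \<mu>. x \<in> K n" for n
    using eq1[of n] K[of n] by (intro AE_in_if_emeasure_eq_1) (simp_all add: inv(2))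
  then have "AE x in \<mu>. x \<in> (\<Inter>n. K n)" by (simp add: AE_all_countable)
  moreover have "(\<Inter>n. K n) \<in> sets \<mu>" using K inv(2) by blast
  ultimately show ?thesis
    by (metis AE_in_set_eq_1 UN_ZX emeasure_eq_measure ennreal_1)
qed

text \<open>Both sides are the common point mass times the number of points of \<open>A\<close> in
  the cycle. The product form also covers cycles of mass zero, on which \<mu> cannot be
  conditioned.\<close>

lemma invariant_emeasure_Int_ZX:
  assumes lam: "0 < lam" and \<mu>: "\<mu> \<in> invariant_probs borelX (TX lam)"
    and A: "A \<in> sets borelX"
  shows "emeasure \<mu> (A \<inter> ZX m) = emeasure \<mu> (ZX m) * emeasure (mu m) A"
proof -
  note inv = invariant_probsD[OF \<mu>]
  have sing: "{x} \<in> sets \<mu>" if "x \<in> ZX m" for x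
    using that singleton_in_sets ZX_subset inv(2) by blast
  have step: "emeasure \<mu> {TX lam x} = emeasure \<mu> {x}" if "x \<in> ZX m" for x
  proof -
    have "x \<in> XX" "TX lam x \<in> XX"
      using that ZX_subset[of m] bij_betwE[OF bij_betw_TX_ZX[OF lam]] by blast+
    \<comment> \<open>Invariance speaks of preimages; injectivity on \<open>XX\<close> makes the
      preimage of the image point a single point.\<close>
    then have "TX lam -` {TX lam x} \<inter> XX = {x}"
      using inj_on_TX[OF lam] by (auto dest: inj_onD)
    then show ?thesis using inv(4)[OF singleton_in_sets[OF \<open>TX lam x \<in> XX\<close>]] by simp
  qed
  have "ZX m \<noteq> {}" using card_ZX[of m] by (auto simp: per_def)
  then obtain z where z: "z \<in> ZX m" by blast
  define c where "c = emeasure \<mu> {z}"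
  have const: "emeasure \<mu> {x} = c" if "x \<in> ZX m" for x
    unfolding c_def using step that z by (rule TX_invariant_const_on_ZX)
  have mass: "emeasure \<mu> (B \<inter> ZX m) = c * (\<Sum>x\<in>ZX m. indicator B x)" for B
  proof -
    have "emeasure \<mu> (B \<inter> ZX m) = (\<Sum>x\<in>B \<inter> ZX m. emeasure \<mu> {x})"
      using sing by (intro emeasure_eq_sum_singleton) auto
    also have "\<dots> = (\<Sum>x\<in>B \<inter> ZX m. c)" using const by (intro sum.cong) auto
    also have "\<dots> = (\<Sum>x\<in>ZX m. c * indicator B x)"
      by (intro sum.mono_neutral_cong_left) (auto simp: indicator_def)
    finally show ?thesis by (simp add: sum_distrib_left)
  qed
  have "emeasure \<mu> (ZX m) = c * of_nat (per m)"
    using mass[of "ZX m"] by (simp add: card_ZX)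
  then have "emeasure \<mu> (ZX m) * emeasure (mu m) A
      = c * ((\<Sum>x\<in>ZX m. indicator A x) * (of_nat (per m) / of_nat (per m)))"
    using A by (simp add: emeasure_mu_eq_sum divide_ennreal_def ac_simps)
  also have "of_nat (per m) / of_nat (per m) = (1 :: ennreal)"
    by (rule ennreal_divide_self[OF _ of_nat_less_top]) (simp add: per_def)
  finally show ?thesis by (simp add: mass)
qed

text \<open>Up to a null set, \<open>A\<close> is the disjoint union of its traces on the
  cycles.\<close>

lemma invariant_emeasure_eq_suminf:
  assumes lam: "0 < lam" "lam < 1" and \<mu>: "\<mu> \<in> invariant_probs borelX (TX lam)"
    and A: "A \<in> sets borelX"
  shows "emeasure \<mu> A = (\<Sum>m. emeasure \<mu> (ZX m) * emeasure (mu m) A)"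
proof -
  note inv = invariant_probsD[OF \<mu>]
  interpret prob_space \<mu> by (rule inv)
  have Z: "(\<Union>m. ZX m) \<in> sets \<mu>" unfolding inv(2) by (rule UN_ZX_sets)
  have "AE x in \<mu>. x \<in> (\<Union>m. ZX m)"
    by (rule AE_in_if_emeasure_eq_1[OF Z invariant_emeasure_zero_fibre[OF lam \<mu>]])
  then have "emeasure \<mu> A = emeasure \<mu> (\<Union>m. A \<inter> ZX m)"
    by (intro emeasure_eq_AE) (use A Z in \<open>auto simp: inv(2)\<close>)
  also have "\<dots> = (\<Sum>m. emeasure \<mu> (A \<inter> ZX m))"
  proof (rule suminf_emeasure[symmetric])
    show "range (\<lambda>m. A \<inter> ZX m) \<subseteq> sets \<mu>"
      unfolding inv(2) using A by (intro image_subsetI sets.Int ZX_sets)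
    show "disjoint_family (\<lambda>m. A \<inter> ZX m)"
      using disjoint_ZX by (rule disjoint_family_on_bisimulation) blast
  qed
  finally show ?thesis using invariant_emeasure_Int_ZX[OF lam(1) \<mu> A] by simp
qed

text \<open>Only \<open>mu m\<close> charges \<open>ZX m\<close>, so evaluating a mixture there
  recovers its weight; this gives uniqueness.\<close>

lemma mixture_mu_ZX: "emeasure (mixture borelX w mu) (ZX m) = ennreal (w m)"
proof -
  have [simp]: "emeasure (mu k) (ZX m) = (if k = m then 1 else 0)" for k
    using disjoint_ZX emeasure_mu_Z emeasure_mu_eq_0 by (auto simp: disjoint_family_on_def)
  then have "emeasure (mixture borelX w mu) (ZX m) = (\<Sum>k. if k = m then ennreal (w k) else 0)"
    by (subst emeasure_mixture) (auto intro!: suminf_cong simp: emeasure_mu_Z)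
  also have "\<dots> = ennreal (w m)"
    using sums_single[of m "\<lambda>k. ennreal (w k)"] by (simp add: sums_iff)
  finally show ?thesis .
qed

lemma invariant_mixture:
  assumes lam: "0 < lam" "lam < 1" and \<mu>: "\<mu> \<in> invariant_probs borelX (TX lam)"
  shows "(\<lambda>m. measure \<mu> (ZX m)) sums 1" "\<mu> = mixture borelX (\<lambda>m. measure \<mu> (ZX m)) mu"
proof -
  note inv = invariant_probsD[OF \<mu>]
  interpret prob_space \<mu> by (rule inv)
  have "(\<lambda>m. measure \<mu> (ZX m)) sums measure \<mu> (\<Union>m. ZX m)"
    by (rule finite_measure_UNION[OF _ disjoint_ZX]) (simp add: inv(2) image_subset_iff)
  then show "(\<lambda>m. measure \<mu> (ZX m)) sums 1"
    using invariant_emeasure_zero_fibre[OF lam \<mu>] by (simp add: measure_def)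
  show "\<mu> = mixture borelX (\<lambda>m. measure \<mu> (ZX m)) mu"
  proof (rule measure_eqI)
    fix A assume "A \<in> events"
    then have A: "A \<in> sets borelX" by (simp add: inv(2))
    show "emeasure \<mu> A = emeasure (mixture borelX (\<lambda>m. measure \<mu> (ZX m)) mu) A"
      unfolding emeasure_mixture[OF sets_mu A] emeasure_eq_measure[symmetric]
      by (rule invariant_emeasure_eq_suminf[OF lam \<mu> A])
  qed (simp add: inv(2))
qed

lemma invariant_mixture_unique:
  assumes "0 < lam" "lam < 1" "\<mu> \<in> invariant_probs borelX (TX lam)"
  shows "\<exists>!w. (\<forall>m. 0 \<le> w m) \<and> w sums 1 \<and> \<mu> = mixture borelX w mu"
proof (rule ex1I)
  show "(\<forall>m. 0 \<le> measure \<mu> (ZX m)) \<and> (\<lambda>m. measure \<mu> (ZX m)) sums 1 \<and>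
      \<mu> = mixture borelX (\<lambda>m. measure \<mu> (ZX m)) mu"
    using invariant_mixture[OF assms] by simp
  fix w :: "nat \<Rightarrow> real"
  assume "(\<forall>m. 0 \<le> w m) \<and> w sums 1 \<and> \<mu> = mixture borelX w mu"
  \<comment> \<open>\<open>ennreal\<close> sends negative reals to 0, so nonnegativity of
    \<open>w\<close> is what lets \<open>w m\<close> be read off from
    \<open>ennreal (w m)\<close>.\<close>
  then have "w m = measure \<mu> (ZX m)" for m
    using mixture_mu_ZX[of w m] by (simp add: measure_def)
  then show "w = (\<lambda>m. measure \<mu> (ZX m))" by auto
qed

section \<open>Classification of the ergodic measures\<close>

lemma ergodic_in_range_mu:
  assumes lam: "0 < lam" "lam < 1" and \<mu>: "\<mu> \<in> ergodic_probs borelX (TX lam)"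
  shows "\<mu> \<in> range mu"
proof -
  have inv\<mu>: "\<mu> \<in> invariant_probs borelX (TX lam)" using \<mu> by (simp add: ergodic_probs_def)
  note inv = invariant_probsD[OF inv\<mu>]
  interpret prob_space \<mu> by (rule inv)
  have "TX lam -` ZX m \<inter> XX = ZX m" for m
    using TX_in_ZX_iff[OF lam(1)] ZX_subset[of m] by blast
  then have dich: "emeasure \<mu> (ZX m) = 0 \<or> emeasure \<mu> (ZX m) = 1" for m
    using \<mu> by (simp add: ergodic_probs_def)
  \<comment> \<open>The masses of the cycles sum to 1, so they cannot all vanish.\<close>
  have "\<exists>m. emeasure \<mu> (ZX m) = 1"
  proof (rule ccontr)
    assume "\<nexists>m. emeasure \<mu> (ZX m) = 1"
    then have "(\<lambda>m. measure \<mu> (ZX m)) = (\<lambda>m. 0)"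
      using dich by (auto simp: measure_def)
    then show False using invariant_mixture(1)[OF lam inv\<mu>] by (simp add: sums_iff)
  qed
  then obtain m where m: "emeasure \<mu> (ZX m) = 1" by blast
  then have ae: "AE x in \<mu>. x \<in> ZX m"
    by (intro AE_in_if_emeasure_eq_1) (simp_all add: inv(2))
  have "emeasure \<mu> A = emeasure (mu m) A" if A: "A \<in> sets borelX" for A
  proof -
    have "emeasure \<mu> A = emeasure \<mu> (A \<inter> ZX m)"
      by (intro emeasure_eq_AE) (use A ae in \<open>auto simp: inv(2)\<close>)
    then show ?thesis using invariant_emeasure_Int_ZX[OF lam(1) inv\<mu> A] m by simp
  qed
  then have "\<mu> = mu m" by (intro measure_eqI) (simp_all add: inv(2))
  then show ?thesis by simp
qed

theorem proposition5p3:
  fixes lam :: real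
  assumes "0 < lam" and "lam < 1"
  shows "(\<forall>\<mu> \<in> invariant_probs borelX (TX lam).
            \<exists>!w :: nat \<Rightarrow> real. (\<forall>m. 0 \<le> w m) \<and> w sums 1 \<and> \<mu> = mixture borelX w mu)
       \<and> ergodic_probs borelX (TX lam) = range mu
       \<and> weak_star_converges topX mu (mu 0)"
  using invariant_mixture_unique[OF assms] mu_ergodic[OF assms] ergodic_in_range_mu[OF assms]
    mu_weak_star_converges by blast

end
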